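(* Let $(\Omega,\mathcal H)$ be a paved space, with $\mathcal H$ a ring of sets and $\Omega$ a countable disjoint union of elements of $\mathcal H$, and let $(X,\eta_1),(Y,\eta_2),(Z,\eta_3)$ be vector spaces with net convergence structures connected by a bilinear product $\bullet:X\times Y\to Z$, where $\eta_3$ is the convergence of a Hausdorff vector space topology on $Z$. Let $\mu:\mathcal H\to Y$ be a set function. If $f:\Omega\to X$ is $S^*$-integrable with respect to $\mu$ (i.e. $f\in L_{S^*}(\mu)$), then $f$ is Sion integrable with respect to $\mu$.
   Context: A net convergence structure $\eta$ on a set $V$ assigns to each $v\in V$ a class of nets in $V$ ("converging to $v$") such that: (i) constant nets $v$ converge to $v$; (ii) every quasi-subnet of a net converging to $v$ converges to $v$, where $(y_j)_{j\in J}$ is a quasi-subnet of $(x_i)_{i\in I}$ if for every $i_0$ there is $j_0$ with $\{y_j:j\ge j_0\}\subseteq\{x_i:i\ge i_0\}$; (iii) if $(x_i)_{i\in I},(y_i)_{i\in I}$ converge to $v$ and $z_i\in\{x_i,y_i\}$ for all $i$, then $(z_i)$ converges to $v$. Standing assumptions: real vector spaces, Hausdorff structures (unique limits), continuous addition and multiplication by fixed reals. A paved space is a nonempty set $\Omega$ with $\mathcal H\subseteq 2^\Omega$, $\emptyset\in\mathcal H$. A bilinear product is a bilinear map, written by juxtaposition, continuous (preserving convergent nets) in each argument separately. For $A\in\mathcal H$ (or $A=\Omega$), $\mathcal P(A)$ is the set of countable disjoint coverings $P=\{\alpha_j\}_j$ of $A$ by nonempty sets of $\mathcal H$, ordered by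 refinement: $P\le Q$ iff every member of $Q$ is contained in a member of $P$; $\mathcal P(A)$ is assumed nonempty and directed. A choice function $\delta$ assigns to each nonempty $\alpha\subseteq\Omega$ a point $\delta_\alpha\in\alpha$. A family $(z_j)_{j\in I}$ in $Z$ is unconditionally summable to $z$ if the net of finite sums $\big(\sum_{j\in J}z_j\big)_{J\subseteq I\text{ finite}}$, ordered by inclusion, converges to $z$. $f:\Omega\to X$ is $S^*$-integrable on $A$ with respect to $\mu$ with integral $z\in Z$ if there is $P_*\in\mathcal P(A)$ such that for all $P\ge P_*$ and all choice functions $\delta$ the series $\sum_{\alpha\in P}f(\delta_\alpha)\mu(\alpha)$ is unconditionally summable in $Z$, and the net of these sums converges to $z$ along refinement, independently of $\delta$ (i.e. as a net indexed by pairs $(P,\delta)$, $P\ge P_*$, preordered by refinement of $P$ only). $L_{S^*}(\mu)$ is the set of $f$ that are $S^*$-integrable on every $A\in\mathcal H$ (and on $\Omega$). Sion integral: a truncation is a map $\Delta$ assigning to each $P\in\mathcal P(A)$ a finite subfamily $\Delta(P)\subseteq P$. Pairs $(P,\Delta)$ are ordered by $(Q,\Delta_2)\gg(P,\Delta_1)$ iff $Q$ refines $P$ and $\Delta_1(M)\subseteq\Delta_2(M)$ for every $M\in\mathcal P(A)$ refining $Q$. $f$ is Sion integrable on $A$ if the sums $\sum_{\alpha\in\Delta(P)}f(\delta_\alpha)\mu(\alpha)$ converge in $Z$ along this order, independently of the choice of points $\delta_\alpha\in\alpha$ (i.e. as a net indexed by triples $(P,\delta,\Delta)$, preordered by $(P,\Delta)$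 only). $f$ is Sion integrable if it is so on $\Omega$ (and likewise on each $A\in\mathcal H$). *)

theory Defs
  imports "HOL-Analysis.Analysis"
begin

section \<open>Nets and net convergence structures\<close>

datatype ('i, 'v) net = Net (idx: "'i set") (le: "'i \<Rightarrow> 'i \<Rightarrow> bool") (val: "'i \<Rightarrow> 'v")

text \<open>
  Index sets are directed and preordered; antisymmetry is not required. Only the behaviour of
  \<^term>\<open>le N\<close> and \<^term>\<open>val N\<close> on the index set is relevant.
\<close>

definition is_net :: "('i, 'v) net \<Rightarrow> bool" where
  "is_net N \<longleftrightarrow> idx N \<noteq> {} \<and>
     (\<forall>i\<in>idx N. le N i i) \<and>
     (\<forall>i\<in>idx N. \<forall>j\<in>idx N. \<forall>k\<in>idx N. le N i j \<longrightarrow> le N j k \<longrightarrow> le N i k) \<and>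
     (\<forall>i\<in>idx N. \<forall>j\<in>idx N. \<exists>k\<in>idx N. le N i k \<and> le N j k)"

definition tail :: "('i, 'v) net \<Rightarrow> 'i \<Rightarrow> 'v set" where
  "tail N i = val N ` {j \<in> idx N. le N i j}"

definition quasi_subnet :: "('j, 'v) net \<Rightarrow> ('i, 'v) net \<Rightarrow> bool" where
  "quasi_subnet M N \<longleftrightarrow> (\<forall>i\<in>idx N. \<exists>j\<in>idx M. tail M j \<subseteq> tail N i)"

text \<open>
  HOL cannot quantify over nets with index sets of all types at once. A convergence structure on
  \<^typ>\<open>'v\<close> is therefore recorded by its nets with index sets contained in \<^typ>\<open>'v \<times> 'v set\<close>.
  Nothing is lost: every net has the same tails as one of these (lemma \<open>standard_net\<close> below), the
  two are quasi-subnets of each other, and so closure under quasi-subnets determines which nets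
  over other index types converge; see \<open>converges_in\<close>.
\<close>

type_synonym 'v conv = "('v \<times> 'v set, 'v) net \<Rightarrow> 'v \<Rightarrow> bool"

definition net_convergence_structure :: "'v conv \<Rightarrow> bool" where
  "net_convergence_structure \<eta> \<longleftrightarrow>
     (\<forall>N v. \<eta> N v \<longrightarrow> is_net N) \<and>
     (\<forall>N v. is_net N \<and> (\<forall>i\<in>idx N. val N i = v) \<longrightarrow> \<eta> N v) \<and>
     (\<forall>N M v. \<eta> N v \<and> is_net M \<and> quasi_subnet M N \<longrightarrow> \<eta> M v) \<and>
     (\<forall>I r x y z v. \<eta> (Net I r x) v \<and> \<eta> (Net I r y) v \<and> (\<forall>i\<in>I. z i \<in> {x i, y i})
        \<longrightarrow> \<eta> (Net I r z) v)"

text \<open>Convergence of a net over an arbitrary index type.\<close>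

definition converges_in :: "'v conv \<Rightarrow> ('i, 'v) net \<Rightarrow> 'v \<Rightarrow> bool" where
  "converges_in \<eta> N v \<longleftrightarrow> is_net N \<and> (\<exists>M. \<eta> M v \<and> quasi_subnet N M)"

definition convergence_vector_space :: "('v::real_vector) conv \<Rightarrow> bool" where
  "convergence_vector_space \<eta> \<longleftrightarrow> net_convergence_structure \<eta> \<and>
     (\<forall>N v w. \<eta> N v \<and> \<eta> N w \<longrightarrow> v = w) \<and>
     (\<forall>I r x y v w. \<eta> (Net I r x) v \<and> \<eta> (Net I r y) w
        \<longrightarrow> \<eta> (Net I r (\<lambda>i. x i + y i)) (v + w)) \<and>
     (\<forall>I r x v c. \<eta> (Net I r x) v \<longrightarrow> \<eta> (Net I r (\<lambda>i. c *\<^sub>R x i)) (c *\<^sub>R v))"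

definition bilinear_product ::
    "('x::real_vector) conv \<Rightarrow> ('y::real_vector) conv \<Rightarrow> ('z::real_vector) conv
      \<Rightarrow> ('x \<Rightarrow> 'y \<Rightarrow> 'z) \<Rightarrow> bool" where
  "bilinear_product \<eta>\<^sub>1 \<eta>\<^sub>2 \<eta>\<^sub>3 B \<longleftrightarrow> bilinear B \<and>
     (\<forall>I r x v y. \<eta>\<^sub>1 (Net I r x) v \<longrightarrow> converges_in \<eta>\<^sub>3 (Net I r (\<lambda>i. B (x i) y)) (B v y)) \<and>
     (\<forall>I r y w x. \<eta>\<^sub>2 (Net I r y) w \<longrightarrow> converges_in \<eta>\<^sub>3 (Net I r (\<lambda>i. B x (y i))) (B x w))"

definition tail_filter :: "('i, 'v) net \<Rightarrow> 'i filter" where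
  "tail_filter N = (INF i\<in>idx N. principal {j \<in> idx N. le N i j})"

definition topological_convergence :: "'v topology \<Rightarrow> 'v conv" where
  "topological_convergence T N v \<longleftrightarrow> is_net N \<and> limitin T (val N) v (tail_filter N)"

definition vector_space_topology :: "('v::real_vector) topology \<Rightarrow> bool" where
  "vector_space_topology T \<longleftrightarrow> topspace T = UNIV \<and>
     continuous_map (prod_topology T T) T (\<lambda>(v, w). v + w) \<and>
     continuous_map (prod_topology euclideanreal T) T (\<lambda>(c, v). c *\<^sub>R v)"

section \<open>Paved spaces and coverings\<close>

definition paved_space :: "'a set \<Rightarrow> 'a set set \<Rightarrow> bool" where
  "paved_space \<Omega> H \<longleftrightarrow> \<Omega> \<noteq> {} \<and> H \<subseteq> Pow \<Omega> \<and> {} \<in> H"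

text \<open>
  The members of a covering are nonempty and disjoint, hence pairwise distinct, so a covering is
  a set of sets. The only covering of the empty set is the empty family.
\<close>

definition coverings :: "'a set set \<Rightarrow> 'a set \<Rightarrow> 'a set set set" where
  "coverings H A = {P. countable P \<and> P \<subseteq> H \<and> {} \<notin> P \<and> disjoint P \<and> \<Union>P = A}"

definition refined_by :: "'a set set \<Rightarrow> 'a set set \<Rightarrow> bool" (infix "\<sqsubseteq>\<^sub>r" 50) where
  "P \<sqsubseteq>\<^sub>r Q \<longleftrightarrow> (\<forall>\<beta>\<in>Q. \<exists>\<alpha>\<in>P. \<beta> \<subseteq> \<alpha>)"

definition coverings_directed :: "'a set \<Rightarrow> 'a set set \<Rightarrow> bool" where
  "coverings_directed \<Omega> H \<longleftrightarrow> (\<forall>A\<in>insert \<Omega> H. coverings H A \<noteq> {} \<and>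
     (\<forall>P\<in>coverings H A. \<forall>Q\<in>coverings H A. \<exists>R\<in>coverings H A. P \<sqsubseteq>\<^sub>r R \<and> Q \<sqsubseteq>\<^sub>r R))"

definition choices :: "'a set \<Rightarrow> ('a set \<Rightarrow> 'a) set" where
  "choices \<Omega> = {\<delta>. \<forall>\<alpha>. \<alpha> \<subseteq> \<Omega> \<and> \<alpha> \<noteq> {} \<longrightarrow> \<delta> \<alpha> \<in> \<alpha>}"

definition truncations :: "'a set set \<Rightarrow> 'a set \<Rightarrow> ('a set set \<Rightarrow> 'a set set) set" where
  "truncations H A = {\<Delta>. \<forall>P\<in>coverings H A. finite (\<Delta> P) \<and> \<Delta> P \<subseteq> P}"

section \<open>The integrals\<close>

definition unconditional_sum :: "('z::real_vector) conv \<Rightarrow> ('j \<Rightarrow> 'z) \<Rightarrow> 'j set \<Rightarrow> 'z \<Rightarrow> bool" where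
  "unconditional_sum \<eta> g I z \<longleftrightarrow>
     converges_in \<eta> (Net {J. finite J \<and> J \<subseteq> I} (\<subseteq>) (\<lambda>J. \<Sum>j\<in>J. g j)) z"

text \<open>
  The sum of a series, selected by \<open>THE\<close>, is meaningful for summable families only, limits being
  unique.
\<close>

definition S_star_integral ::
    "('z::real_vector) conv \<Rightarrow> ('x::real_vector \<Rightarrow> 'y::real_vector \<Rightarrow> 'z) \<Rightarrow> 'a set \<Rightarrow> 'a set set
      \<Rightarrow> ('a \<Rightarrow> 'x) \<Rightarrow> ('a set \<Rightarrow> 'y) \<Rightarrow> 'a set \<Rightarrow> 'z \<Rightarrow> bool" where
  "S_star_integral \<eta> B \<Omega> H f \<mu> A z \<longleftrightarrow> (\<exists>P\<^sub>0\<in>coverings H A.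
     (\<forall>P\<in>coverings H A. P\<^sub>0 \<sqsubseteq>\<^sub>r P \<longrightarrow> (\<forall>\<delta>\<in>choices \<Omega>.
        \<exists>s. unconditional_sum \<eta> (\<lambda>\<alpha>. B (f (\<delta> \<alpha>)) (\<mu> \<alpha>)) P s)) \<and>
     converges_in \<eta>
       (Net {(P, \<delta>). P \<in> coverings H A \<and> P\<^sub>0 \<sqsubseteq>\<^sub>r P \<and> \<delta> \<in> choices \<Omega>}
            (\<lambda>(P, _) (Q, _). P \<sqsubseteq>\<^sub>r Q)
            (\<lambda>(P, \<delta>). THE s. unconditional_sum \<eta> (\<lambda>\<alpha>. B (f (\<delta> \<alpha>)) (\<mu> \<alpha>)) P s)) z)"

definition L_S_star ::
    "('z::real_vector) conv \<Rightarrow> ('x::real_vector \<Rightarrow> 'y::real_vector \<Rightarrow> 'z) \<Rightarrow> 'a set \<Rightarrow> 'a set set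
      \<Rightarrow> ('a set \<Rightarrow> 'y) \<Rightarrow> ('a \<Rightarrow> 'x) set" where
  "L_S_star \<eta> B \<Omega> H \<mu> = {f. \<forall>A\<in>insert \<Omega> H. \<exists>z. S_star_integral \<eta> B \<Omega> H f \<mu> A z}"

definition truncation_le ::
    "'a set set \<Rightarrow> 'a set \<Rightarrow> 'a set set \<times> ('a set set \<Rightarrow> 'a set set)
      \<Rightarrow> 'a set set \<times> ('a set set \<Rightarrow> 'a set set) \<Rightarrow> bool" where
  "truncation_le H A = (\<lambda>(P, \<Delta>\<^sub>1) (Q, \<Delta>\<^sub>2).
     P \<sqsubseteq>\<^sub>r Q \<and> (\<forall>M\<in>coverings H A. Q \<sqsubseteq>\<^sub>r M \<longrightarrow> \<Delta>\<^sub>1 M \<subseteq> \<Delta>\<^sub>2 M))"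

definition Sion_integral ::
    "('z::real_vector) conv \<Rightarrow> ('x::real_vector \<Rightarrow> 'y::real_vector \<Rightarrow> 'z) \<Rightarrow> 'a set \<Rightarrow> 'a set set
      \<Rightarrow> ('a \<Rightarrow> 'x) \<Rightarrow> ('a set \<Rightarrow> 'y) \<Rightarrow> 'a set \<Rightarrow> 'z \<Rightarrow> bool" where
  "Sion_integral \<eta> B \<Omega> H f \<mu> A z \<longleftrightarrow>
     converges_in \<eta>
       (Net (coverings H A \<times> choices \<Omega> \<times> truncations H A)
            (\<lambda>(P, _, \<Delta>\<^sub>1) (Q, _, \<Delta>\<^sub>2). truncation_le H A (P, \<Delta>\<^sub>1) (Q, \<Delta>\<^sub>2))
            (\<lambda>(P, \<delta>, \<Delta>). \<Sum>\<alpha>\<in>\<Delta> P. B (f (\<delta> \<alpha>)) (\<mu> \<alpha>))) z"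

definition Sion_integrable ::
    "('z::real_vector) conv \<Rightarrow> ('x::real_vector \<Rightarrow> 'y::real_vector \<Rightarrow> 'z) \<Rightarrow> 'a set \<Rightarrow> 'a set set
      \<Rightarrow> ('a set \<Rightarrow> 'y) \<Rightarrow> ('a \<Rightarrow> 'x) \<Rightarrow> bool" where
  "Sion_integrable \<eta> B \<Omega> H \<mu> f \<longleftrightarrow> (\<forall>A\<in>insert \<Omega> H. \<exists>z. Sion_integral \<eta> B \<Omega> H f \<mu> A z)"

section \<open>Adequacy of the index type\<close>

lemma standard_net:
  fixes N :: "('i, 'v) net"
  assumes N: "is_net N"
  shows "\<exists>M :: ('v \<times> 'v set, 'v) net. is_net M \<and> tail M ` idx M = tail N ` idx N \<and>
           quasi_subnet M N \<and> quasi_subnet N M"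
proof -
  define \<T> where "\<T> = tail N ` idx N"
  define M :: "('v \<times> 'v set, 'v) net" where
    "M = Net {(v, F). F \<in> \<T> \<and> v \<in> F} (\<lambda>p q. snd q \<subseteq> snd p) fst"
  have M [simp]: "p \<in> idx M \<longleftrightarrow> snd p \<in> \<T> \<and> fst p \<in> snd p" "le M p q \<longleftrightarrow> snd q \<subseteq> snd p"
      "val M p = fst p" for p q
    by (auto simp: M_def)
  have ne: "F \<noteq> {}" if "F \<in> \<T>" for F
    using N that unfolding is_net_def \<T>_def tail_def by blast
  have ne\<T>: "\<T> \<noteq> {}"
    using N unfolding is_net_def \<T>_def by blast
  have dir: "\<exists>K\<in>\<T>. K \<subseteq> F \<and> K \<subseteq> G" if FG: "F \<in> \<T>" "G \<in> \<T>" for F G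
  proof -
    obtain i j where ij: "i \<in> idx N" "j \<in> idx N" "F = tail N i" "G = tail N j"
      using FG unfolding \<T>_def by blast
    obtain k where k: "k \<in> idx N" "le N i k" "le N j k"
      using N ij unfolding is_net_def by meson
    have "le N i l" "le N j l" if "l \<in> idx N" "le N k l" for l
      using N ij k that unfolding is_net_def by meson+
    then have "tail N k \<subseteq> F" "tail N k \<subseteq> G"
      unfolding ij tail_def by auto
    then show ?thesis using k unfolding \<T>_def by blast
  qed
  have tM: "tail M p = snd p" if "snd p \<in> \<T>" for p
  proof
    show "tail M p \<subseteq> snd p" unfolding tail_def by auto
    show "snd p \<subseteq> tail M p"
    proof
      fix v assume "v \<in> snd p"
      then show "v \<in> tail M p"
        unfolding tail_def using that by (intro image_eqI[of _ _ "(v, snd p)"]) simp_all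
    qed
  qed
  have tails: "tail M ` idx M = \<T>"
  proof
    show "tail M ` idx M \<subseteq> \<T>" using tM by auto
    show "\<T> \<subseteq> tail M ` idx M"
    proof
      fix F assume F: "F \<in> \<T>"
      then obtain v where "v \<in> F" using ne by blast
      then show "F \<in> tail M ` idx M"
        using F tM[of "(v, F)"] by (intro image_eqI[of _ _ "(v, F)"]) simp_all
    qed
  qed
  have "is_net M"
    unfolding is_net_def
  proof (intro conjI ballI impI)
    show "idx M \<noteq> {}" using tails ne\<T> by blast
  next
    fix p q assume "p \<in> idx M" "q \<in> idx M"
    then obtain K where K: "K \<in> \<T>" "K \<subseteq> snd p" "K \<subseteq> snd q"
      using dir[of "snd p" "snd q"] by auto
    then obtain v where "v \<in> K" using ne by blast
    with K show "\<exists>c\<in>idx M. le M p c \<and> le M q c" by (intro bexI[of _ "(v, K)"]) simp_all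
  next
    fix p q r assume "le M p q" "le M q r"
    then show "le M p r" by simp
  qed simp
  moreover have "quasi_subnet M N"
    unfolding quasi_subnet_def
  proof
    fix i assume "i \<in> idx N"
    then have "tail N i \<in> tail M ` idx M" using tails \<T>_def by blast
    then obtain p where "p \<in> idx M" "tail N i = tail M p" by (rule imageE)
    then show "\<exists>p\<in>idx M. tail M p \<subseteq> tail N i" by blast
  qed
  moreover have "quasi_subnet N M"
    unfolding quasi_subnet_def
  proof
    fix p assume "p \<in> idx M"
    then have "tail M p \<in> tail N ` idx N" using tails \<T>_def by blast
    then obtain i where "i \<in> idx N" "tail M p = tail N i" by (rule imageE)
    then show "\<exists>i\<in>idx N. tail N i \<subseteq> tail M p" by blast
  qed
  ultimately show ?thesis using tails \<T>_def by blast
qed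

lemma quasi_subnet_trans: "quasi_subnet L M \<Longrightarrow> quasi_subnet M N \<Longrightarrow> quasi_subnet L N"
  unfolding quasi_subnet_def by (meson subset_trans)

lemma converges_in_standard:
  assumes "net_convergence_structure \<eta>"
  shows "converges_in \<eta> N v \<longleftrightarrow> \<eta> N v"
proof -
  have "quasi_subnet N N" unfolding quasi_subnet_def by blast
  moreover have "\<eta> N v \<Longrightarrow> is_net N" for N v
    using assms unfolding net_convergence_structure_def by blast
  moreover have "\<eta> M v" if "\<eta> N v" "is_net M" "quasi_subnet M N" for N M v
    using assms that unfolding net_convergence_structure_def by blast
  ultimately show ?thesis unfolding converges_in_def by blast
qed

lemma converges_in_unique:
  assumes \<eta>: "net_convergence_structure \<eta>" and u: "\<And>N v w. \<eta> N v \<Longrightarrow> \<eta> N w \<Longrightarrow> v = w"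
    and "converges_in \<eta> N v" "converges_in \<eta> N w"
  shows "v = w"
proof -
  obtain M :: "('a \<times> 'a set, 'a) net" where M: "is_net M" "quasi_subnet M N"
    using standard_net assms(3) unfolding converges_in_def by blast
  have "converges_in \<eta> M v" "converges_in \<eta> M w"
    using M assms(3,4) quasi_subnet_trans unfolding converges_in_def by blast+
  then have "\<eta> M v" "\<eta> M w" by (simp_all add: converges_in_standard[OF \<eta>])
  then show ?thesis by (rule u)
qed

lemma eventually_tail_filter:
  assumes N: "is_net N"
  shows "eventually P (tail_filter N) \<longleftrightarrow> (\<exists>i\<in>idx N. \<forall>j\<in>idx N. le N i j \<longrightarrow> P j)"
proof -
  let ?S = "\<lambda>i. {j \<in> idx N. le N i j}"
  have dir: "\<exists>k\<in>idx N. principal (?S k) \<le> inf (principal (?S i)) (principal (?S j))"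
    if ij: "i \<in> idx N" "j \<in> idx N" for i j
  proof -
    obtain k where k: "k \<in> idx N" "le N i k" "le N j k"
      using N ij unfolding is_net_def by meson
    have "le N i l" "le N j l" if "l \<in> idx N" "le N k l" for l
      using N ij k that unfolding is_net_def by meson+
    then have "?S k \<subseteq> ?S i \<inter> ?S j" by blast
    then show ?thesis using k(1) by auto
  qed
  have "idx N \<noteq> {}" using N unfolding is_net_def by blast
  then have "eventually P (tail_filter N) \<longleftrightarrow> (\<exists>i\<in>idx N. eventually P (principal (?S i)))"
    unfolding tail_filter_def by (rule eventually_INF_base[OF _ dir])
  then show ?thesis unfolding eventually_principal by blast
qed

lemma limitin_net_iff:
  assumes "is_net N"
  shows "limitin T (val N) v (tail_filter N) \<longleftrightarrow>
           v \<in> topspace T \<and> (\<forall>U. openin T U \<and> v \<in> U \<longrightarrow> (\<exists>i\<in>idx N. tail N i \<subseteq> U))"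
proof -
  have "tail N i \<subseteq> U \<longleftrightarrow> (\<forall>j\<in>idx N. le N i j \<longrightarrow> val N j \<in> U)" for i U
    unfolding tail_def by blast
  then show ?thesis unfolding limitin_def eventually_tail_filter[OF assms] by simp
qed

lemma limitin_quasi_subnet:
  assumes "is_net N" "is_net M" "quasi_subnet M N" "limitin T (val N) v (tail_filter N)"
  shows "limitin T (val M) v (tail_filter M)"
  unfolding limitin_net_iff[OF assms(2)]
proof (intro conjI allI impI)
  show "v \<in> topspace T" using assms(4) by (simp add: limitin_def)
next
  fix U assume "openin T U \<and> v \<in> U"
  then obtain i where i: "i \<in> idx N" "tail N i \<subseteq> U"
    using assms(4) unfolding limitin_net_iff[OF assms(1)] by blast
  then obtain j where "j \<in> idx M" "tail M j \<subseteq> tail N i"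
    using assms(3) unfolding quasi_subnet_def by blast
  with i show "\<exists>j\<in>idx M. tail M j \<subseteq> U" by blast
qed

lemma converges_in_topological:
  fixes N :: "('i, 'v) net"
  shows "converges_in (topological_convergence T) N v \<longleftrightarrow>
     is_net N \<and> limitin T (val N) v (tail_filter N)"
proof
  assume "converges_in (topological_convergence T) N v"
  then obtain M where N: "is_net N" and M: "topological_convergence T M v" "quasi_subnet N M"
    unfolding converges_in_def by blast
  show "is_net N \<and> limitin T (val N) v (tail_filter N)"
    using N M limitin_quasi_subnet[OF _ N M(2)] unfolding topological_convergence_def by simp
next
  assume N: "is_net N \<and> limitin T (val N) v (tail_filter N)"
  then obtain M :: "('v \<times> 'v set, 'v) net"
    where M: "is_net M" "quasi_subnet M N" "quasi_subnet N M"
    using standard_net[of N] by blast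
  then have "topological_convergence T M v"
    using N limitin_quasi_subnet[of N M T v] unfolding topological_convergence_def by simp
  with M N show "converges_in (topological_convergence T) N v"
    unfolding converges_in_def by blast
qed

lemma net_convergence_structure_topological:
  assumes T: "topspace T = UNIV"
  shows "net_convergence_structure (topological_convergence T)"
proof -
  let ?lim = "\<lambda>N v. is_net N \<and> limitin T (val N) v (tail_filter N)"
  have const: "?lim N v"
    if N: "is_net N" "\<forall>i\<in>idx N. val N i = v" for N :: "('a \<times> 'a set, 'a) net" and v
  proof -
    obtain i where "i \<in> idx N" using N(1) unfolding is_net_def by blast
    moreover have "tail N i \<subseteq> {v}" using N(2) unfolding tail_def by auto
    ultimately show ?thesis using N(1) T by (auto simp: limitin_net_iff)
  qed
  have mix: "?lim (Net I r z) v"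
    if x: "?lim (Net I r x) v" and y: "?lim (Net I r y) v"
      and z: "\<forall>i\<in>I. z i \<in> {x i, y i}"
    for I r and x y z :: "'a \<times> 'a set \<Rightarrow> 'a" and v
  proof -
    have n: "is_net (Net I r z)"
      using conjunct1[OF x] unfolding is_net_def net.sel .
    have "\<exists>i\<in>I. tail (Net I r z) i \<subseteq> U" if U: "openin T U" "v \<in> U" for U
    proof -
      obtain i where i: "i \<in> I" "tail (Net I r x) i \<subseteq> U"
        using x U limitin_net_iff[of "Net I r x" T v] unfolding net.sel by blast
      obtain j where j: "j \<in> I" "tail (Net I r y) j \<subseteq> U"
        using y U limitin_net_iff[of "Net I r y" T v] unfolding net.sel by blast
      obtain k where k: "k \<in> I" "r i k" "r j k"
        using n i(1) j(1) unfolding is_net_def net.sel by meson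
      have "z l \<in> U" if l: "l \<in> I" "r k l" for l
      proof -
        have "r i l" "r j l"
          using n i(1) j(1) k l unfolding is_net_def net.sel by meson+
        then have "x l \<in> U" "y l \<in> U"
          using i(2) j(2) l(1) unfolding tail_def net.sel by blast+
        moreover have "z l = x l \<or> z l = y l" using z l(1) by blast
        ultimately show ?thesis by metis
      qed
      then show ?thesis using k(1) unfolding tail_def net.sel by blast
    qed
    then show ?thesis using n T limitin_net_iff[OF n, of T v] by simp
  qed
  have sub: "?lim M v" if "?lim N v" "is_net M" "quasi_subnet M N"
    for N M :: "('a \<times> 'a set, 'a) net" and v
    using that limitin_quasi_subnet[of N M T v] by simp
  show ?thesis
    unfolding net_convergence_structure_def topological_convergence_def
  proof (intro conjI[OF _ conjI[OF _ conjI]] allI impI)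
    fix N :: "('a \<times> 'a set, 'a) net" and v
    assume "?lim N v"
    then show "is_net N" by (rule conjunct1)
  next
    fix N :: "('a \<times> 'a set, 'a) net" and v
    assume "is_net N \<and> (\<forall>i\<in>idx N. val N i = v)"
    then show "?lim N v" using const[of N v] by (elim conjE)
  next
    fix N M :: "('a \<times> 'a set, 'a) net" and v
    assume a: "?lim N v \<and> is_net M \<and> quasi_subnet M N"
    show "?lim M v"
      by (rule sub[OF conjunct1[OF a] conjunct1[OF conjunct2[OF a]] conjunct2[OF conjunct2[OF a]]])
  next
    fix I r and x y z :: "'a \<times> 'a set \<Rightarrow> 'a" and v
    assume a: "?lim (Net I r x) v \<and> ?lim (Net I r y) v \<and> (\<forall>i\<in>I. z i \<in> {x i, y i})"
    show "?lim (Net I r z) v"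
      by (rule mix[OF conjunct1[OF a] conjunct1[OF conjunct2[OF a]] conjunct2[OF conjunct2[OF a]]])
  qed
qed

end

theory Submission
  imports Defs
begin

text \<open>
  Fix a covering \<open>A = \<Union>P\<close> fine enough for all its series to be summable. The point is that they are
  summable uniformly in the choice function: for every neighbourhood \<open>V\<close> of \<open>0\<close> there is a finite
  \<open>F \<subseteq> P\<close> such that every sum over a finite subfamily of \<open>P - F\<close> lies in \<open>V\<close>, whatever points
  are chosen (\<open>uniform_cauchy_over_selections\<close>). Otherwise there would be infinitely many
  disjoint finite blocks, each with its own choice function making the sum over the block leave
  \<open>V\<close>. The values of a choice function on different sets are independent of each other, so these
  choice functions can be glued to a single one, and its series would fail the Cauchy condition.

  Uniformity is what the Sion order requires, since a truncation \<open>\<Delta>\<close> does not see the choice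
  function. Given a neighbourhood of the \<open>S\<^sup>*\<close>-integral \<open>z\<close>, let \<open>P\<^sub>1\<close> be a covering beyond which all
  series sums are close to \<open>z\<close>, and let \<open>\<Delta> Q\<close> be the finite set \<open>F\<close> obtained for \<open>Q\<close>, for each \<open>Q\<close>
  refining \<open>P\<^sub>1\<close>. Beyond \<open>(P\<^sub>1, \<Delta>)\<close> in the Sion order a truncated sum runs over a finite set
  containing \<open>F\<close>. It differs from larger finite sums by elements of \<open>V\<close>, and these approach the
  sum of the series. So every truncated sum is close to \<open>z\<close>, and the Sion integral is the
  \<open>S\<^sup>*\<close>-integral, on each \<open>A\<close> separately.
\<close>

section \<open>Cauchy conditions uniform in the selection\<close>

text \<open>
  A gliding hump: if no finite set served all selections, a selection violating the hypothesis
  could be glued from selections that are bad on successive disjoint blocks. Gluing works because a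
  sum over a block depends only on the values of the selection on that block.
\<close>

lemma uniform_cauchy_over_selections:
  fixes h :: "'j \<Rightarrow> 'c \<Rightarrow> 'z::comm_monoid_add"
  assumes cauchy: "\<And>d. d \<in> Pi K C \<Longrightarrow>
      \<exists>F. finite F \<and> F \<subseteq> I \<and> (\<forall>J. finite J \<and> J \<subseteq> I - F \<longrightarrow> (\<Sum>j\<in>J. h j (d j)) \<in> V)"
  shows "\<exists>F. finite F \<and> F \<subseteq> I \<and>
      (\<forall>d\<in>Pi K C. \<forall>J. finite J \<and> J \<subseteq> I - F \<longrightarrow> (\<Sum>j\<in>J. h j (d j)) \<in> V)"
proof (rule ccontr)
  define tame where "tame F d \<longleftrightarrow> (\<forall>J. finite J \<and> J \<subseteq> I - F \<longrightarrow> (\<Sum>j\<in>J. h j (d j)) \<in> V)" for F d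
  assume "\<not> ?thesis"
  then have "\<not> (\<exists>F. finite F \<and> F \<subseteq> I \<and> (\<forall>d\<in>Pi K C. tame F d))"
    unfolding tame_def .
  then have bad: "\<exists>d\<in>Pi K C. \<not> tame F d" if "finite F" "F \<subseteq> I" for F
    using that by metis
  have "\<exists>G. \<forall>n. (finite (G n) \<and> G n \<subseteq> I) \<and>
      (G n \<subseteq> G (Suc n) \<and> (\<exists>d\<in>Pi K C. (\<Sum>j\<in>G (Suc n) - G n. h j (d j)) \<notin> V))"
  proof (rule dependent_nat_choice)
    show "\<exists>F. finite F \<and> F \<subseteq> I" by blast
  next
    fix F and n :: nat
    assume F: "finite F \<and> F \<subseteq> I"
    then obtain d J where J: "d \<in> Pi K C" "finite J" "J \<subseteq> I - F" "(\<Sum>j\<in>J. h j (d j)) \<notin> V"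
      using bad[of F] unfolding tame_def by auto
    have "(F \<union> J) - F = J" using J(3) by blast
    with F J show "\<exists>F'. (finite F' \<and> F' \<subseteq> I) \<and>
        (F \<subseteq> F' \<and> (\<exists>d\<in>Pi K C. (\<Sum>j\<in>F' - F. h j (d j)) \<notin> V))"
      by (intro exI[of _ "F \<union> J"] conjI bexI[of _ d]) auto
  qed
  then obtain G where G: "\<forall>n. (finite (G n) \<and> G n \<subseteq> I) \<and>
      (G n \<subseteq> G (Suc n) \<and> (\<exists>d\<in>Pi K C. (\<Sum>j\<in>G (Suc n) - G n. h j (d j)) \<notin> V))" ..
  then have fin: "finite (G n)" and sub: "G n \<subseteq> I" and step: "G n \<subseteq> G (Suc n)" for n
    by simp_all
  from G have "\<forall>n. \<exists>d. d \<in> Pi K C \<and> (\<Sum>j\<in>G (Suc n) - G n. h j (d j)) \<notin> V"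
    unfolding Bex_def by simp
  from choice[OF this] obtain d where "\<forall>n. d n \<in> Pi K C \<and> (\<Sum>j\<in>G (Suc n) - G n. h j (d n j)) \<notin> V" ..
  then have d: "d n \<in> Pi K C" and hump: "(\<Sum>j\<in>G (Suc n) - G n. h j (d n j)) \<notin> V" for n
    by simp_all
  have mono: "G m \<subseteq> G n" if "m \<le> n" for m n
    using that step by (rule lift_Suc_mono_le[rotated])
  \<comment> \<open>The block containing \<open>j\<close> is the first one to reach \<open>j\<close>. Outside all blocks the \<open>LEAST\<close> is an
    unspecified number, and every \<open>d n\<close> is admissible there.\<close>
  define e where "e j = d (LEAST n. j \<in> G (Suc n)) j" for j
  have "e \<in> Pi K C" using d unfolding e_def Pi_iff by blast
  from cauchy[OF this] obtain F where F: "finite F" "tame F e"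
    unfolding tame_def by (elim exE conjE)
  have e: "e j = d n j" if "j \<in> G (Suc n) - G n" for j n
  proof -
    have "(LEAST m. j \<in> G (Suc m)) = n"
    proof (rule Least_equality)
      show "j \<in> G (Suc n)" using that by blast
      show "n \<le> m" if "j \<in> G (Suc m)" for m
        using mono[of "Suc m" n] \<open>j \<in> G (Suc n) - G n\<close> that not_less_eq_eq by blast
    qed
    then show ?thesis by (simp add: e_def)
  qed
  have "\<exists>n. F \<inter> (\<Union>k. G k) \<subseteq> G n"
  proof -
    let ?S = "F \<inter> (\<Union>k. G k)"
    have fin_S: "finite ?S" using F(1) by blast
    have "\<forall>x\<in>?S. \<exists>k. x \<in> G k" by blast
    from bchoice[OF this] obtain k where k: "\<forall>x\<in>?S. x \<in> G (k x)" ..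
    have "x \<in> G (Max (k ` ?S))" if "x \<in> ?S" for x
    proof -
      have "k x \<le> Max (k ` ?S)" using fin_S that by (intro Max_ge) auto
      then show ?thesis using mono k that by blast
    qed
    then show ?thesis by blast
  qed
  then obtain n where "F \<inter> (\<Union>k. G k) \<subseteq> G n" ..
  then have "G (Suc n) - G n \<subseteq> I - F" using sub by blast
  then have "(\<Sum>j\<in>G (Suc n) - G n. h j (e j)) \<in> V"
    using F(2) fin unfolding tame_def by simp
  moreover have "(\<Sum>j\<in>G (Suc n) - G n. h j (e j)) = (\<Sum>j\<in>G (Suc n) - G n. h j (d n j))"
    by (intro sum.cong refl) (simp add: e)
  ultimately show False using hump[of n] by simp
qed

section \<open>Unconditional sums in topological vector spaces\<close>

lemma vector_space_topology_diff:
  assumes T: "vector_space_topology T" and U: "openin T U" "a - b \<in> U"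
  obtains V W where "openin T V" "openin T W" "a \<in> V" "b \<in> W"
    "\<And>x y. x \<in> V \<Longrightarrow> y \<in> W \<Longrightarrow> x - y \<in> U"
proof -
  have top: "topspace T = UNIV"
    and add: "continuous_map (prod_topology T T) T (\<lambda>(v, w). v + w)"
    and scale: "continuous_map (prod_topology euclideanreal T) T (\<lambda>(c, v). c *\<^sub>R v)"
    using T unfolding vector_space_topology_def by auto
  have "continuous_map T (prod_topology euclideanreal T) (\<lambda>v. (-1, v))"
    by (simp add: continuous_map_pairwise o_def)
  from continuous_map_compose[OF this scale] have neg: "continuous_map T T uminus"
    by (simp add: o_def)
  have "continuous_map (prod_topology T T) (prod_topology T T) (\<lambda>p. (fst p, - snd p))"
    using continuous_map_compose[OF continuous_map_snd neg, of T]
    by (simp add: continuous_map_pairwise o_def continuous_map_fst)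
  from continuous_map_compose[OF this add]
  have "continuous_map (prod_topology T T) T (\<lambda>p. fst p - snd p)"
    by (simp add: o_def)
  from openin_continuous_map_preimage[OF this U(1)]
  have "openin (prod_topology T T) {p. fst p - snd p \<in> U}"
    by (simp add: top)
  then have "\<exists>V W. openin T V \<and> openin T W \<and> a \<in> V \<and> b \<in> W \<and>
      V \<times> W \<subseteq> {p. fst p - snd p \<in> U}"
    unfolding openin_prod_topology_alt by (elim allE impE) (simp_all add: U(2))
  then obtain V W where VW: "openin T V" "openin T W" "a \<in> V" "b \<in> W"
    "V \<times> W \<subseteq> {p. fst p - snd p \<in> U}"
    by (elim exE conjE)
  have "x - y \<in> U" if "x \<in> V" "y \<in> W" for x y
    using subsetD[OF VW(5), of "(x, y)"] that by simp
  with VW(1-4) show thesis by (rule that)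
qed

lemma unconditional_sum_topological_iff:
  assumes "topspace T = UNIV"
  shows "unconditional_sum (topological_convergence T) g I s \<longleftrightarrow>
    (\<forall>U. openin T U \<and> s \<in> U \<longrightarrow>
      (\<exists>F. finite F \<and> F \<subseteq> I \<and> (\<forall>J. finite J \<and> F \<subseteq> J \<and> J \<subseteq> I \<longrightarrow> (\<Sum>j\<in>J. g j) \<in> U)))"
proof -
  let ?N = "Net {J. finite J \<and> J \<subseteq> I} (\<subseteq>) (\<lambda>J. \<Sum>j\<in>J. g j)"
  have N: "is_net ?N"
    unfolding is_net_def net.sel
  proof (intro conjI ballI impI)
    fix J K assume "J \<in> {J. finite J \<and> J \<subseteq> I}" "K \<in> {J. finite J \<and> J \<subseteq> I}"
    then show "\<exists>L\<in>{J. finite J \<and> J \<subseteq> I}. J \<subseteq> L \<and> K \<subseteq> L"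
      by (intro bexI[of _ "J \<union> K"]) auto
  qed auto
  have "tail ?N F \<subseteq> U \<longleftrightarrow> (\<forall>J. finite J \<and> F \<subseteq> J \<and> J \<subseteq> I \<longrightarrow> (\<Sum>j\<in>J. g j) \<in> U)" for F U
    unfolding tail_def by auto
  then show ?thesis
    unfolding unconditional_sum_def converges_in_topological limitin_net_iff[OF N]
    using N assms by simp
qed

lemma unconditional_sum_cauchy:
  assumes T: "vector_space_topology T" and sum: "unconditional_sum (topological_convergence T) g I s"
    and V: "openin T V" "0 \<in> V"
  shows "\<exists>F. finite F \<and> F \<subseteq> I \<and> (\<forall>J. finite J \<and> J \<subseteq> I - F \<longrightarrow> (\<Sum>j\<in>J. g j) \<in> V)"
proof -
  have top: "topspace T = UNIV" using T unfolding vector_space_topology_def by blast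
  have "s - s \<in> V" using V(2) by simp
  then obtain W\<^sub>1 W\<^sub>2 where W: "openin T W\<^sub>1" "openin T W\<^sub>2" "s \<in> W\<^sub>1" "s \<in> W\<^sub>2"
    "\<And>x y. x \<in> W\<^sub>1 \<Longrightarrow> y \<in> W\<^sub>2 \<Longrightarrow> x - y \<in> V"
    using vector_space_topology_diff[OF T V(1)] by metis
  have "openin T (W\<^sub>1 \<inter> W\<^sub>2)" "s \<in> W\<^sub>1 \<inter> W\<^sub>2" using W by auto
  then obtain F where F: "finite F" "F \<subseteq> I"
    "\<And>J. finite J \<Longrightarrow> F \<subseteq> J \<Longrightarrow> J \<subseteq> I \<Longrightarrow> (\<Sum>j\<in>J. g j) \<in> W\<^sub>1 \<inter> W\<^sub>2"
    using sum unfolding unconditional_sum_topological_iff[OF top] by metis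
  have "(\<Sum>j\<in>J. g j) \<in> V" if J: "finite J" "J \<subseteq> I - F" for J
  proof -
    have "(\<Sum>j\<in>F \<union> J. g j) = (\<Sum>j\<in>F. g j) + (\<Sum>j\<in>J. g j)"
      using J F(1) by (intro sum.union_disjoint) auto
    moreover have "(\<Sum>j\<in>F \<union> J. g j) - (\<Sum>j\<in>F. g j) \<in> V"
    proof (rule W(5))
      show "(\<Sum>j\<in>F \<union> J. g j) \<in> W\<^sub>1" using F(3)[of "F \<union> J"] J F(1,2) by blast
      show "(\<Sum>j\<in>F. g j) \<in> W\<^sub>2" using F(3)[of F] F(1,2) by blast
    qed
    ultimately show ?thesis by simp
  qed
  with F(1,2) show ?thesis by blast
qed

lemma tail_filter_nontrivial:
  assumes "is_net N"
  shows "tail_filter N \<noteq> bot"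
proof -
  have "\<not> eventually (\<lambda>_. False) (tail_filter N)"
    using assms unfolding eventually_tail_filter[OF assms] is_net_def by blast
  then show ?thesis by auto
qed

lemma unconditional_sum_the:
  assumes "Hausdorff_space T" "unconditional_sum (topological_convergence T) g I s"
  shows "(THE s. unconditional_sum (topological_convergence T) g I s) = s"
  using assms(2)
proof (rule the_equality)
  fix t assume t: "unconditional_sum (topological_convergence T) g I t"
  let ?N = "Net {J. finite J \<and> J \<subseteq> I} (\<subseteq>) (\<lambda>J. \<Sum>j\<in>J. g j)"
  have N: "is_net ?N" and s: "limitin T (val ?N) s (tail_filter ?N)"
    and t: "limitin T (val ?N) t (tail_filter ?N)"
    using assms(2) t unfolding unconditional_sum_def converges_in_topological by simp_all
  show "t = s"
    using limitin_Hausdorff_unique[OF t s tail_filter_nontrivial[OF N] assms(1)] .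
qed

section \<open>From the \<open>S\<^sup>*\<close>-integral to the Sion integral\<close>

text \<open>
  As a product of sets, the choice functions admit gluing.
\<close>

lemma choices_eq_Pi: "choices \<Omega> = Pi (Pow \<Omega> - {{}}) (\<lambda>\<alpha>. \<alpha>)"
  unfolding choices_def by auto

lemma choices_nonempty: "choices \<Omega> \<noteq> {}"
  unfolding choices_eq_Pi by (simp add: Pi_eq_empty)

lemma refined_by_refl: "P \<sqsubseteq>\<^sub>r P"
  unfolding refined_by_def by blast

lemma refined_by_trans: "P \<sqsubseteq>\<^sub>r Q \<Longrightarrow> Q \<sqsubseteq>\<^sub>r R \<Longrightarrow> P \<sqsubseteq>\<^sub>r R"
  unfolding refined_by_def by (meson subset_trans)

text \<open>
  An upper bound of two index triples takes a common refinement of the coverings and the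
  pointwise union of the truncations. Its choice function may be any one, as the order ignores it.
\<close>

lemma Sion_net_is_net:
  assumes dir: "coverings_directed \<Omega> H" and A: "A \<in> insert \<Omega> H"
  shows "is_net (Net (coverings H A \<times> choices \<Omega> \<times> truncations H A)
            (\<lambda>(P, _, \<Delta>\<^sub>1) (Q, _, \<Delta>\<^sub>2). truncation_le H A (P, \<Delta>\<^sub>1) (Q, \<Delta>\<^sub>2)) x)"
  (is "is_net (Net ?I ?le x)")
  unfolding is_net_def net.sel
proof (intro conjI ballI impI)
  have "(\<lambda>_. {}) \<in> truncations H A" unfolding truncations_def by simp
  moreover have "coverings H A \<noteq> {}" using dir A unfolding coverings_directed_def by blast
  ultimately show "?I \<noteq> {}" using choices_nonempty by blast
next
  fix i show "?le i i"
    by (auto simp: truncation_le_def refined_by_refl split: prod.splits)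
next
  fix i j k assume "?le i j" "?le j k"
  then show "?le i k"
    by (auto simp: truncation_le_def split: prod.splits) (meson refined_by_trans subset_iff)+
next
  fix i j assume ij: "i \<in> ?I" "j \<in> ?I"
  then obtain P \<delta> \<Delta>\<^sub>1 Q \<epsilon> \<Delta>\<^sub>2 where [simp]: "i = (P, \<delta>, \<Delta>\<^sub>1)" "j = (Q, \<epsilon>, \<Delta>\<^sub>2)"
    by (metis prod_cases3)
  obtain R where R: "R \<in> coverings H A" "P \<sqsubseteq>\<^sub>r R" "Q \<sqsubseteq>\<^sub>r R"
    using dir A ij unfolding coverings_directed_def by simp blast
  have "(R, \<delta>, \<lambda>M. \<Delta>\<^sub>1 M \<union> \<Delta>\<^sub>2 M) \<in> ?I"
    using ij R(1) unfolding truncations_def by auto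
  then show "\<exists>k\<in>?I. ?le i k \<and> ?le j k"
    using R(2,3) by (intro bexI[of _ "(R, \<delta>, \<lambda>M. \<Delta>\<^sub>1 M \<union> \<Delta>\<^sub>2 M)"]) (simp_all add: truncation_le_def)
qed

text \<open>
  A truncation that keeps, of each sufficiently fine covering, a finite set outside which all finite
  sums are small for every choice function at once is a threshold in the Sion order: beyond it,
  a truncated sum misses only a small remainder of its series.
\<close>

lemma S_star_integral_imp_Sion_integral:
  fixes T :: "'z::real_vector topology"
  assumes T: "vector_space_topology T" "Hausdorff_space T"
    and dir: "coverings_directed \<Omega> H" and A: "A \<in> insert \<Omega> H"
    and S: "S_star_integral (topological_convergence T) B \<Omega> H f \<mu> A z"
  shows "Sion_integral (topological_convergence T) B \<Omega> H f \<mu> A z"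
proof -
  let ?g = "\<lambda>\<delta> \<alpha>. B (f (\<delta> \<alpha>)) (\<mu> \<alpha>)"
  let ?sum = "unconditional_sum (topological_convergence T)"
  have top: "topspace T = UNIV" using T unfolding vector_space_topology_def by blast
  obtain P\<^sub>0 where summable: "\<And>P \<delta>. P \<in> coverings H A \<Longrightarrow> P\<^sub>0 \<sqsubseteq>\<^sub>r P \<Longrightarrow> \<delta> \<in> choices \<Omega> \<Longrightarrow>
        \<exists>s. ?sum (?g \<delta>) P s"
    and conv: "converges_in (topological_convergence T)
       (Net {(P, \<delta>). P \<in> coverings H A \<and> P\<^sub>0 \<sqsubseteq>\<^sub>r P \<and> \<delta> \<in> choices \<Omega>}
            (\<lambda>(P, _) (Q, _). P \<sqsubseteq>\<^sub>r Q) (\<lambda>(P, \<delta>). THE s. ?sum (?g \<delta>) P s)) z"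
    using S unfolding S_star_integral_def by blast
  have near: "\<exists>P\<^sub>1\<in>coverings H A. \<forall>Q\<in>coverings H A. P\<^sub>1 \<sqsubseteq>\<^sub>r Q \<longrightarrow>
      (\<forall>\<delta>\<in>choices \<Omega>. \<exists>s\<in>W. ?sum (?g \<delta>) Q s)"
    if W: "openin T W" "z \<in> W" for W
  proof -
    let ?N = "Net {(P, \<delta>). P \<in> coverings H A \<and> P\<^sub>0 \<sqsubseteq>\<^sub>r P \<and> \<delta> \<in> choices \<Omega>}
            (\<lambda>(P, _) (Q, _). P \<sqsubseteq>\<^sub>r Q) (\<lambda>(P, \<delta>). THE s. ?sum (?g \<delta>) P s)"
    have N: "is_net ?N" and lim: "limitin T (val ?N) z (tail_filter ?N)"
      using conv unfolding converges_in_topological by blast+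
    obtain i where i: "i \<in> idx ?N" "tail ?N i \<subseteq> W"
      using lim W unfolding limitin_net_iff[OF N] by blast
    obtain P\<^sub>1 \<delta>\<^sub>1 where [simp]: "i = (P\<^sub>1, \<delta>\<^sub>1)" by (cases i)
    have P1: "P\<^sub>1 \<in> coverings H A" "P\<^sub>0 \<sqsubseteq>\<^sub>r P\<^sub>1" using i(1) by auto
    have "\<exists>s\<in>W. ?sum (?g \<delta>) Q s"
      if Q: "Q \<in> coverings H A" "P\<^sub>1 \<sqsubseteq>\<^sub>r Q" "\<delta> \<in> choices \<Omega>" for Q \<delta>
    proof -
      have Q0: "P\<^sub>0 \<sqsubseteq>\<^sub>r Q" using P1(2) Q(2) by (rule refined_by_trans)
      then obtain s where s: "?sum (?g \<delta>) Q s" using summable Q by blast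
      have "(THE s. ?sum (?g \<delta>) Q s) \<in> tail ?N i"
        unfolding tail_def using Q Q0 by (intro image_eqI[of _ _ "(Q, \<delta>)"]) auto
      then show ?thesis
        using i(2) s unfolding unconditional_sum_the[OF T(2) s] by blast
    qed
    with P1(1) show ?thesis by blast
  qed
  let ?M = "Net (coverings H A \<times> choices \<Omega> \<times> truncations H A)
            (\<lambda>(P, _, \<Delta>\<^sub>1) (Q, _, \<Delta>\<^sub>2). truncation_le H A (P, \<Delta>\<^sub>1) (Q, \<Delta>\<^sub>2))
            (\<lambda>(P, \<delta>, \<Delta>). \<Sum>\<alpha>\<in>\<Delta> P. ?g \<delta> \<alpha>)"
  have M: "is_net ?M" using dir A by (rule Sion_net_is_net)
  have "\<exists>i\<in>idx ?M. tail ?M i \<subseteq> U" if U: "openin T U" "z \<in> U" for U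
  proof -
    have "z - 0 \<in> U" using U(2) by simp
    then obtain W V where WV: "openin T W" "openin T V" "z \<in> W" "0 \<in> V"
      "\<And>x y. x \<in> W \<Longrightarrow> y \<in> V \<Longrightarrow> x - y \<in> U"
      using vector_space_topology_diff[OF T(1) U(1)] by metis
    obtain P\<^sub>1 where P1: "P\<^sub>1 \<in> coverings H A"
      and sums: "\<And>Q \<delta>. Q \<in> coverings H A \<Longrightarrow> P\<^sub>1 \<sqsubseteq>\<^sub>r Q \<Longrightarrow> \<delta> \<in> choices \<Omega> \<Longrightarrow>
          \<exists>s\<in>W. ?sum (?g \<delta>) Q s"
      using near[OF WV(1,3)] by metis
    define serves where "serves Q F \<longleftrightarrow> finite F \<and> F \<subseteq> Q \<and>
        (\<forall>\<delta>\<in>choices \<Omega>. \<forall>J. finite J \<and> J \<subseteq> Q - F \<longrightarrow> sum (?g \<delta>) J \<in> V)" for Q F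
    have "\<exists>F. serves Q F" if Q: "Q \<in> coverings H A" "P\<^sub>1 \<sqsubseteq>\<^sub>r Q" for Q
      unfolding serves_def choices_eq_Pi
    proof (rule uniform_cauchy_over_selections)
      fix \<delta> assume "\<delta> \<in> Pi (Pow \<Omega> - {{}}) (\<lambda>\<alpha>. \<alpha>)"
      then obtain s where "?sum (?g \<delta>) Q s" using sums Q unfolding choices_eq_Pi by blast
      then show "\<exists>F. finite F \<and> F \<subseteq> Q \<and> (\<forall>J. finite J \<and> J \<subseteq> Q - F \<longrightarrow> sum (?g \<delta>) J \<in> V)"
        using WV(2,4) by (rule unconditional_sum_cauchy[OF T(1)])
    qed
    then obtain F where F: "\<And>Q. Q \<in> coverings H A \<Longrightarrow> P\<^sub>1 \<sqsubseteq>\<^sub>r Q \<Longrightarrow> serves Q (F Q)"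
      by metis
    \<comment> \<open>A truncation is defined on all coverings, but \<open>F Q\<close> is meaningful only if \<open>Q\<close> refines \<open>P\<^sub>1\<close>.
      The default value \<open>{}\<close> elsewhere makes \<open>\<Delta>\<^sub>0\<close> a truncation and is never compared.\<close>
    define \<Delta>\<^sub>0 where "\<Delta>\<^sub>0 Q = (if P\<^sub>1 \<sqsubseteq>\<^sub>r Q then F Q else {})" for Q
    have \<Delta>0: "\<Delta>\<^sub>0 \<in> truncations H A" using F unfolding truncations_def \<Delta>\<^sub>0_def serves_def by auto
    obtain \<delta>\<^sub>0 where \<delta>0: "\<delta>\<^sub>0 \<in> choices \<Omega>" using choices_nonempty by blast
    have "sum (?g \<delta>) (\<Delta> Q) \<in> U"
      if Q: "Q \<in> coverings H A" "\<delta> \<in> choices \<Omega>" "\<Delta> \<in> truncations H A"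
        and le: "truncation_le H A (P\<^sub>1, \<Delta>\<^sub>0) (Q, \<Delta>)" for Q \<delta> \<Delta>
    proof -
      have ref: "P\<^sub>1 \<sqsubseteq>\<^sub>r Q" and sub: "\<Delta>\<^sub>0 Q \<subseteq> \<Delta> Q"
        using le Q(1) refined_by_refl unfolding truncation_le_def by auto
      have D: "finite (\<Delta> Q)" "\<Delta> Q \<subseteq> Q" using Q unfolding truncations_def by auto
      obtain s where s: "s \<in> W" "?sum (?g \<delta>) Q s" using sums[OF Q(1) ref Q(2)] by blast
      obtain L where L: "finite L" "L \<subseteq> Q"
        "\<And>J. finite J \<Longrightarrow> L \<subseteq> J \<Longrightarrow> J \<subseteq> Q \<Longrightarrow> sum (?g \<delta>) J \<in> W"
        using s WV(1) unfolding unconditional_sum_topological_iff[OF top] by metis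
      \<comment> \<open>Since \<open>W\<close> is open and contains the sum \<open>s\<close> of the series, it contains the large finite
        sums, and one of those can be compared with the truncated sum in place of \<open>s\<close>.\<close>
      have "sum (?g \<delta>) (\<Delta> Q \<union> L) - sum (?g \<delta>) (L - \<Delta> Q) \<in> U"
      proof (rule WV(5))
        show "sum (?g \<delta>) (\<Delta> Q \<union> L) \<in> W" using L D by simp
        show "sum (?g \<delta>) (L - \<Delta> Q) \<in> V"
        proof -
          have "finite (L - \<Delta> Q)" "L - \<Delta> Q \<subseteq> Q - F Q"
            using sub L(1,2) ref unfolding \<Delta>\<^sub>0_def by auto
          then show ?thesis using F[OF Q(1) ref] Q(2) unfolding serves_def by blast
        qed
      qed
      moreover have "sum (?g \<delta>) (\<Delta> Q \<union> (L - \<Delta> Q)) = sum (?g \<delta>) (\<Delta> Q) + sum (?g \<delta>) (L - \<Delta> Q)"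
        using D L by (intro sum.union_disjoint) auto
      ultimately show ?thesis by simp
    qed
    then have "tail ?M (P\<^sub>1, \<delta>\<^sub>0, \<Delta>\<^sub>0) \<subseteq> U" unfolding tail_def by auto
    moreover have "(P\<^sub>1, \<delta>\<^sub>0, \<Delta>\<^sub>0) \<in> idx ?M" using P1 \<delta>0 \<Delta>0 by simp
    ultimately show ?thesis by blast
  qed
  then have "limitin T (val ?M) z (tail_filter ?M)"
    unfolding limitin_net_iff[OF M] top by blast
  with M show ?thesis
    unfolding Sion_integral_def converges_in_topological by (rule conjI)
qed

theorem proposition3p8:
  fixes \<Omega> :: "'a set" and H :: "'a set set"
    and \<eta>\<^sub>1 :: "('x::real_vector) conv" and \<eta>\<^sub>2 :: "('y::real_vector) conv"
    and \<eta>\<^sub>3 :: "('z::real_vector) conv" and T :: "'z topology"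
    and B :: "'x \<Rightarrow> 'y \<Rightarrow> 'z" and \<mu> :: "'a set \<Rightarrow> 'y" and f :: "'a \<Rightarrow> 'x"
  assumes "paved_space \<Omega> H" and "coverings_directed \<Omega> H"
    and "ring_of_sets \<Omega> H"
    and "\<exists>\<C>. countable \<C> \<and> \<C> \<subseteq> H \<and> disjoint \<C> \<and> \<Union>\<C> = \<Omega>"
    and "convergence_vector_space \<eta>\<^sub>1" and "convergence_vector_space \<eta>\<^sub>2"
    and "vector_space_topology T" and "Hausdorff_space T"
    and "\<eta>\<^sub>3 = topological_convergence T"
    and "bilinear_product \<eta>\<^sub>1 \<eta>\<^sub>2 \<eta>\<^sub>3 B"
    and "f \<in> L_S_star \<eta>\<^sub>3 B \<Omega> H \<mu>"
  shows "Sion_integrable \<eta>\<^sub>3 B \<Omega> H \<mu> f"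
  unfolding Sion_integrable_def assms(9)
proof
  fix A assume A: "A \<in> insert \<Omega> H"
  then obtain z where "S_star_integral (topological_convergence T) B \<Omega> H f \<mu> A z"
    using assms(11) unfolding L_S_star_def assms(9) by blast
  then have "Sion_integral (topological_convergence T) B \<Omega> H f \<mu> A z"
    by (rule S_star_integral_imp_Sion_integral[OF assms(7,8,2) A])
  then show "\<exists>z. Sion_integral (topological_convergence T) B \<Omega> H f \<mu> A z" ..
qed

end
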